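(* Let $\gamma=-0.1$, $\zeta=1.1$, $h(x)=\mathrm{clip}\big(\gamma+(\zeta-\gamma)\sigma(x),0,1\big)$ for $x\in\mathbb{R}$, and $\mathcal{L}=(\zeta-\gamma)/4$. Let $A,\tilde A$ be random matrices with values in $\mathbb{R}^{m\times n}$, defined on a common probability space, and set $H_{ij}=h(A_{ij})$, $\tilde H_{ij}=h(\tilde A_{ij})$, $\Delta A_{ij}=\tilde A_{ij}-A_{ij}$ and $\Delta H_{ij}=\tilde H_{ij}-H_{ij}$. Then for every entry $(i,j)$ and every $\varepsilon>0$, $$\mathbb{P}\big(|\Delta H_{ij}|>\varepsilon\big)\le \mathbb{P}\big(|\Delta A_{ij}|>\varepsilon/\mathcal{L}\big).$$
   Context: $\sigma(x)=1/(1+e^{-x})$ is the sigmoid function. $\mathrm{clip}(y,0,1)=\min\{\max\{y,0\},1\}$. Deterministic matrices are allowed as a special case of random ones. *)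

theory Defs
  imports "HOL-Probability.Probability"
begin

definition sigmoid :: "real \<Rightarrow> real" where
  "sigmoid x = 1 / (1 + exp (- x))"

definition clip :: "real \<Rightarrow> real \<Rightarrow> real \<Rightarrow> real" where
  "clip y a b = min (max y a) b"

definition stretch_lo :: real where
  "stretch_lo = - 0.1"

definition stretch_hi :: real where
  "stretch_hi = 1.1"

definition stretched_gate :: "real \<Rightarrow> real" where
  "stretched_gate x = clip (stretch_lo + (stretch_hi - stretch_lo) * sigmoid x) 0 1"

(* The sigmoid has derivative at most 1/4, whence this Lipschitz constant of the gate. *)
definition gate_const :: real where
  "gate_const = (stretch_hi - stretch_lo) / 4"

end

theory Submission
  imports Defs
begin

text \<open>The gate is Lipschitz with constant \<open>gate_const\<close>
  (\<open>stretched_gate_lipschitz\<close>): the sigmoid s has derivative s (1 - s) \<le> 1/4, the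
  affine stretch multiplies distances by \<open>stretch_hi - stretch_lo\<close>, and clipping does
  not increase them. Since the gate acts entrywise, at every outcome the change of an entry of H is
  at most \<open>gate_const\<close> times the change of the same entry of A. So the event on the
  left is contained in the one on the right, and monotonicity of the measure concludes.\<close>

lemma sigmoid_has_real_derivative:
  "(sigmoid has_real_derivative sigmoid x * (1 - sigmoid x)) (at x)"
proof -
  have pos: "1 + exp (- x) > 0" by (simp add: add_pos_pos)
  show ?thesis
    unfolding sigmoid_def [abs_def] using pos
    by (auto intro!: derivative_eq_intros simp: field_simps power2_eq_square)
qed

text \<open>Mean value inequality on the whole line, with the derivative bounded by 1/4.\<close>

lemma sigmoid_lipschitz: "\<bar>sigmoid y - sigmoid x\<bar> \<le> \<bar>y - x\<bar> / 4"
proof -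
  have "norm (sigmoid y - sigmoid x) \<le> 1/4 * norm (y - x)"
  proof (rule field_differentiable_bound [where S = UNIV])
    show "(sigmoid has_field_derivative sigmoid z * (1 - sigmoid z)) (at z within UNIV)" for z
      by (rule sigmoid_has_real_derivative)
    show "norm (sigmoid z * (1 - sigmoid z)) \<le> 1/4" for z
    proof -
      have "0 \<le> sigmoid z" "sigmoid z \<le> 1"
        by (simp_all add: sigmoid_def add_pos_pos)
      then have "0 \<le> sigmoid z * (1 - sigmoid z)" by simp
      \<comment> \<open>Expanding this square gives s (1 - s) \<le> 1/4 for s =
        \<open>sigmoid z\<close>.\<close>
      moreover have "0 \<le> (sigmoid z - 1/2)\<^sup>2" by simp
      ultimately show ?thesis
        by (simp add: power2_eq_square algebra_simps)
    qed
  qed auto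
  then show ?thesis by simp
qed

lemma clip_nonexpansive: "\<bar>clip y a b - clip x a b\<bar> \<le> \<bar>y - x\<bar>"
  by (auto simp: clip_def min_def max_def)

lemma gate_const_pos: "gate_const > 0"
  by (simp add: gate_const_def stretch_lo_def stretch_hi_def)

lemma stretched_gate_lipschitz:
  "\<bar>stretched_gate y - stretched_gate x\<bar> \<le> gate_const * \<bar>y - x\<bar>"
proof -
  let ?c = "stretch_hi - stretch_lo"
  have "\<bar>stretched_gate y - stretched_gate x\<bar>
      \<le> \<bar>(stretch_lo + ?c * sigmoid y) - (stretch_lo + ?c * sigmoid x)\<bar>"
    unfolding stretched_gate_def by (rule clip_nonexpansive)
  also have "\<dots> = ?c * \<bar>sigmoid y - sigmoid x\<bar>"
    \<comment> \<open>Positivity of \<open>gate_const\<close> amounts to \<open>?c > 0\<close>, so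
      \<open>?c\<close> leaves the absolute value unchanged.\<close>
    using gate_const_pos by (simp add: gate_const_def abs_mult flip: right_diff_distrib)
  also have "\<dots> \<le> ?c * (\<bar>y - x\<bar> / 4)"
    using gate_const_pos by (intro mult_left_mono sigmoid_lipschitz) (simp add: gate_const_def)
  finally show ?thesis by (simp add: gate_const_def)
qed

text \<open>Taking an entry is continuous. As a \<open>measurable\<close> rule this lets events
  about single entries be handled automatically.\<close>

lemma borel_measurable_matrix_entry [measurable (raw)]:
  fixes A :: "'a \<Rightarrow> real ^ 'n ^ 'm"
  assumes "A \<in> borel_measurable M"
  shows "(\<lambda>\<omega>. A \<omega> $ i $ j) \<in> borel_measurable M"
  by (rule borel_measurable_continuous_on [OF _ assms]) (intro continuous_intros)

theorem corollary1:
  fixes M :: "'a measure"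
    and A A' :: "'a \<Rightarrow> real ^ 'n ^ 'm"
    and i :: 'm and j :: 'n and \<epsilon> :: real
  defines "H \<equiv> \<lambda>\<omega>. map_matrix stretched_gate (A \<omega>)"
    and "H' \<equiv> \<lambda>\<omega>. map_matrix stretched_gate (A' \<omega>)"
  defines "\<Delta>A \<equiv> \<lambda>\<omega>. A' \<omega> - A \<omega>"
    and "\<Delta>H \<equiv> \<lambda>\<omega>. H' \<omega> - H \<omega>"
  assumes "prob_space M"
    and "A \<in> borel_measurable M" and "A' \<in> borel_measurable M"
    and "\<epsilon> > 0"
  shows "\<P>(\<omega> in M. \<bar>\<Delta>H \<omega> $ i $ j\<bar> > \<epsilon>)
       \<le> \<P>(\<omega> in M. \<bar>\<Delta>A \<omega> $ i $ j\<bar> > \<epsilon> / gate_const)"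
proof -
  interpret prob_space M by fact
  note [measurable] = \<open>A \<in> borel_measurable M\<close> \<open>A' \<in> borel_measurable M\<close>
  have "\<epsilon> / gate_const < \<bar>\<Delta>A \<omega> $ i $ j\<bar>" if "\<epsilon> < \<bar>\<Delta>H \<omega> $ i $ j\<bar>" for \<omega>
  proof -
    have "\<bar>\<Delta>H \<omega> $ i $ j\<bar> \<le> gate_const * \<bar>\<Delta>A \<omega> $ i $ j\<bar>"
      using stretched_gate_lipschitz
      by (simp add: \<Delta>H_def \<Delta>A_def H_def H'_def map_matrix_def)
    with that gate_const_pos show ?thesis by (simp add: divide_less_eq mult.commute)
  qed
  \<comment> \<open>Monotonicity of the measure asks for measurability of the larger event.\<close>
  moreover have "{\<omega> \<in> space M. \<epsilon> / gate_const < \<bar>\<Delta>A \<omega> $ i $ j\<bar>} \<in> events"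
    unfolding \<Delta>A_def by measurable
  ultimately show ?thesis by (intro finite_measure_mono) auto
qed

end
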